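(* Let $n\ge 2$, $0\le l<k\le n$, let $A=\mathrm{diag}(a_1,\dots,a_n)\in\mathcal{A}_{k,l}$, and let $0<\alpha<\beta<\infty$. Then there exists a function $w\in C^2(\alpha,\beta)$ with $w''\not\equiv 0$ in $(\alpha,\beta)$ such that $x\mapsto w\left(\frac12\sum_{i=1}^na_ix_i^2\right)$ is a (generalized symmetric) solution of the equation $$\frac{\sigma_k(\lambda(D^2u))}{\sigma_l(\lambda(D^2u))}=1\quad\text{in}\quad\left\{x\in\mathbb{R}^n:\ \alpha<\tfrac12\sum_{i=1}^na_ix_i^2<\beta\right\}$$ if and only if $$l=0\ \text{ and }\ k=n,\qquad\text{or}\qquad a_1=a_2=\cdots=a_n=c^*(k,l),$$ where $c^*(k,l)=\left(C_n^l/C_n^k\right)^{\frac1{k-l}}$.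
   Context: For a real symmetric matrix $M$, $\lambda(M)=(\lambda_1,\dots,\lambda_n)$ denotes its eigenvalues. $\sigma_j(\lambda)=\sum_{1\le i_1<\cdots<i_j\le n}\lambda_{i_1}\cdots\lambda_{i_j}$ is the $j$-th elementary symmetric function, with $\sigma_0\equiv 1$. $C_n^j=\frac{n!}{(n-j)!\,j!}$ is the binomial coefficient. $\mathcal{A}_{k,l}$ is the set of real $n\times n$ symmetric positive definite matrices $A$ with $\sigma_k(\lambda(A))=\sigma_l(\lambda(A))$. For a diagonal matrix $A=\mathrm{diag}(a_1,\dots,a_n)$, a function $u$ is called generalized symmetric (G-Sym) with respect to $A$ if it is a function of $s=\frac12x^TAx=\frac12\sum_{i=1}^na_ix_i^2$ only; a G-Sym solution of the equation is a solution that is also a G-Sym function with respect to $A$. *)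

theory Defs
  imports "HOL-Analysis.Analysis" "HOL-Computational_Algebra.Computational_Algebra"
begin

definition charpoly :: "real^'n^'n \<Rightarrow> real poly" where
  "charpoly M = det (\<chi> i j. (if i = j then [:0, 1:] else 0) - [:M $ i $ j:])"

(* The real eigenvalues in increasing order, repeated according to algebraic
   multiplicity.  The list has length CARD('n) when M is symmetric, the only case
   in which it is used. *)
definition eigenvalues :: "real^'n^'n \<Rightarrow> real list" where
  "eigenvalues M = sorted_list_of_multiset (proots (charpoly M))"

definition elem_sym :: "nat \<Rightarrow> real list \<Rightarrow> real" where
  "elem_sym j xs = (\<Sum>I | I \<subseteq> {..<length xs} \<and> card I = j. \<Prod>i\<in>I. xs ! i)"

definition diag :: "real^'n \<Rightarrow> real^'n^'n" where
  "diag a = (\<chi> i j. if i = j then a $ i else 0)"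

definition A_set :: "nat \<Rightarrow> nat \<Rightarrow> (real^'n^'n) set" where
  "A_set k l = {A. transpose A = A \<and> (\<forall>x. x \<noteq> 0 \<longrightarrow> x \<bullet> (A *v x) > 0)
     \<and> elem_sym k (eigenvalues A) = elem_sym l (eigenvalues A)}"

definition gradient :: "(real^'n \<Rightarrow> real) \<Rightarrow> real^'n \<Rightarrow> real^'n" where
  "gradient u x = (\<chi> i. frechet_derivative u (at x) (axis i 1))"

definition hessian :: "(real^'n \<Rightarrow> real) \<Rightarrow> real^'n \<Rightarrow> real^'n^'n" where
  "hessian u x = jacobian (gradient u) (at x)"

(* Both C2 predicates are meant for open sets. *)
definition C2_on :: "(real^'n) set \<Rightarrow> (real^'n \<Rightarrow> real) \<Rightarrow> bool" where
  "C2_on S u \<longleftrightarrow> u differentiable_on S \<and> gradient u differentiable_on S \<and> continuous_on S (hessian u)"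

definition C2_real_on :: "real set \<Rightarrow> (real \<Rightarrow> real) \<Rightarrow> bool" where
  "C2_real_on S w \<longleftrightarrow> w differentiable_on S \<and> deriv w differentiable_on S \<and> continuous_on S (deriv (deriv w))"

(* Classical solutions.  Since x / 0 = 0 \<noteq> 1, the equation includes the requirement
   that its denominator does not vanish. *)
definition quotient_solution :: "nat \<Rightarrow> nat \<Rightarrow> (real^'n) set \<Rightarrow> (real^'n \<Rightarrow> real) \<Rightarrow> bool" where
  "quotient_solution k l S u \<longleftrightarrow> C2_on S u \<and>
     (\<forall>x\<in>S. elem_sym k (eigenvalues (hessian u x)) / elem_sym l (eigenvalues (hessian u x)) = 1)"

definition G_Sym_on :: "real^'n^'n \<Rightarrow> (real^'n) set \<Rightarrow> (real^'n \<Rightarrow> real) \<Rightarrow> bool" where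
  "G_Sym_on A S u \<longleftrightarrow> (\<exists>g :: real \<Rightarrow> real. \<forall>x\<in>S. u x = g (1/2 * (x \<bullet> (A *v x))))"

definition c_star :: "nat \<Rightarrow> nat \<Rightarrow> nat \<Rightarrow> real" where
  "c_star n k l = (real (n choose l) / real (n choose k)) powr (1 / (real k - real l))"

end

(* For u(x) = w(s) with s = 1/2 sum a_i x_i^2 the Hessian is w' A + w'' (A x)(A x)^T.

   Necessity: on the level set {s = const} the equation is tested only at the points of the
   coordinate axes, where the Hessian is diagonal with entries w' a_m, except for (w' + 2 s w'') a_i at the
   i-th place. If w''(s) and a_i - a_j are nonzero, subtracting the equations for the axes i and j gives
   w'^(k-1) e_(k-1) = w'^(l-1) e_(l-1), where e_m is the m-th elementary symmetric function of the remaining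
   n - 2 numbers a_m. Unless (k, l) = (n, 0), this makes w'^(k-l) a constant on an interval where w'' does not
   vanish, a contradiction.

   Sufficiency: in both cases the values sigma_k and sigma_l of the Hessian at every point are those at an axis
   point on the same level set (by rotating x if A is scalar, by writing the Hessian as
   A^(1/2) (w' I + w'' y y^T) A^(1/2) and taking determinants if (k, l) = (n, 0)), and the equation becomes
   n G(w') + 2 s (G(w'))' = 0 with G(p) = p^k - p^l. It is solved by G(w') = s^(-n/2) with w' > 1. *)

theory Submission
  imports Defs "HOL-Combinatorics.Permutations"
begin

unbundle no fps_syntax

subsection \<open>Elementary symmetric functions\<close>

text \<open>An arbitrary index set takes the place of the list positions in \<open>elem_sym\<close>,
  so that single coordinates can be deleted from it.\<close>

definition esym :: "nat \<Rightarrow> 'a set \<Rightarrow> ('a \<Rightarrow> real) \<Rightarrow> real" where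
  "esym j S f = (\<Sum>I | I \<subseteq> S \<and> card I = j. \<Prod>i\<in>I. f i)"

lemma esym_cong: "(\<And>i. i \<in> S \<Longrightarrow> f i = g i) \<Longrightarrow> esym j S f = esym j S g"
  unfolding esym_def by (intro sum.cong prod.cong) auto

lemma esym_reindex:
  assumes "bij_betw b T S"
  shows "esym j S f = esym j T (\<lambda>i. f (b i))"
proof -
  have inj: "inj_on b I" if "I \<subseteq> T" for I
    using assms that by (meson bij_betw_imp_inj_on inj_on_subset)
  have "bij_betw ((`) b) {I. I \<subseteq> T \<and> card I = j} {I. I \<subseteq> S \<and> card I = j}"
  proof (rule bij_betw_imageI)
    show "inj_on ((`) b) {I. I \<subseteq> T \<and> card I = j}"
      using assms by (intro inj_onI) (metis (no_types, lifting) bij_betw_imp_inj_on inj_on_image_eq_iff mem_Collect_eq)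
    show "(`) b ` {I. I \<subseteq> T \<and> card I = j} = {I. I \<subseteq> S \<and> card I = j}"
    proof (intro equalityI subsetI)
      fix J assume J: "J \<in> {I. I \<subseteq> S \<and> card I = j}"
      then obtain I where "I \<subseteq> T" "J = b ` I"
        using assms by (metis (no_types, lifting) bij_betw_imp_surj_on mem_Collect_eq subset_imageE)
      then show "J \<in> (`) b ` {I. I \<subseteq> T \<and> card I = j}"
        using J inj by (auto simp: card_image)
    next
      fix J assume "J \<in> (`) b ` {I. I \<subseteq> T \<and> card I = j}"
      then obtain I where I: "I \<subseteq> T" "card I = j" "J = b ` I"
        by auto
      then show "J \<in> {I. I \<subseteq> S \<and> card I = j}"
        using inj[OF I(1)] bij_betw_imp_surj_on[OF assms] by (auto simp: card_image)
    qed
  qed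
  from sum.reindex_bij_betw[OF this, of "prod f"] show ?thesis
    unfolding esym_def using inj by (simp add: prod.reindex)
qed

lemma esym_0 [simp]: "finite S \<Longrightarrow> esym 0 S f = 1"
proof -
  assume "finite S"
  then have "{I. I \<subseteq> S \<and> card I = 0} = {{}}"
    using finite_subset by fastforce
  then show ?thesis by (simp add: esym_def)
qed

lemma esym_const: "finite S \<Longrightarrow> esym j S (\<lambda>_. c) = real (card S choose j) * c ^ j"
  unfolding esym_def by (simp add: n_subsets)

lemma esym_scale: "esym j S (\<lambda>i. c * f i) = c ^ j * esym j S f"
  unfolding esym_def by (simp add: prod.distrib sum_distrib_left)

lemma esym_card: "finite S \<Longrightarrow> esym (card S) S f = prod f S"
proof -
  assume "finite S"
  then have "{I. I \<subseteq> S \<and> card I = card S} = {S}"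
    using card_subset_eq by blast
  then show ?thesis by (simp add: esym_def)
qed

lemma esym_pos:
  assumes "finite S" "j \<le> card S" "\<And>i. i \<in> S \<Longrightarrow> f i > 0"
  shows "esym j S f > 0"
proof -
  obtain I where "I \<subseteq> S" "card I = j"
    using assms(2) by (meson obtain_subset_with_card_n)
  then show ?thesis
    unfolding esym_def using assms by (intro sum_pos prod_pos) auto
qed

text \<open>A subset of \<open>insert i S\<close> with \<open>Suc m\<close> elements either avoids
  \<open>i\<close> or arises from an \<open>m\<close>-element subset of \<open>S\<close> by adding
  \<open>i\<close>.\<close>

lemma esym_insert:
  assumes "finite S" "i \<notin> S"
  shows "esym (Suc m) (insert i S) f = esym (Suc m) S f + f i * esym m S f"
proof -
  let ?A = "{I. I \<subseteq> S \<and> card I = Suc m}" and ?B = "{I. I \<subseteq> S \<and> card I = m}"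
  have fin: "finite I" "i \<notin> I" if "I \<subseteq> S" for I
    using assms that finite_subset by auto
  have split: "{I. I \<subseteq> insert i S \<and> card I = Suc m} = ?A \<union> insert i ` ?B"
  proof (intro equalityI subsetI)
    fix I assume I: "I \<in> {I. I \<subseteq> insert i S \<and> card I = Suc m}"
    show "I \<in> ?A \<union> insert i ` ?B"
    proof (cases "i \<in> I")
      case True
      then have "I = insert i (I - {i})" "I - {i} \<in> ?B"
        using I by auto
      then show ?thesis by blast
    qed (use I in auto)
  qed (use fin in \<open>auto simp: card_insert_if\<close>)
  have "inj_on (insert i) ?B"
    using fin by (intro inj_onI) (auto simp: insert_ident)
  then have "(\<Sum>I\<in>insert i ` ?B. prod f I) = (\<Sum>I\<in>?B. f i * prod f I)"
    using fin by (simp add: sum.reindex)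
  moreover have "?A \<inter> insert i ` ?B = {}"
    using assms by auto
  ultimately show ?thesis
    unfolding esym_def split using assms
    by (subst sum.union_disjoint) (simp_all add: sum_distrib_left)
qed

lemma esym_remove:
  assumes "finite S" "i \<in> S"
  shows "esym (Suc m) S f = esym (Suc m) (S - {i}) f + f i * esym m (S - {i}) f"
  using esym_insert[of "S - {i}" i m f] assms by (simp add: insert_absorb)

text \<open>Expanding along \<open>i\<close> shows that the perturbation \<open>q\<close> of a
  single factor enters linearly. With \<open>p\<close> = w' and \<open>q\<close> = 2 s w'' this
  evaluates the symmetric functions of the Hessian on the \<open>i\<close>-th axis.\<close>

lemma esym_scale_except:
  assumes "finite S" "i \<in> S"
  shows "esym (Suc m) S (\<lambda>j. (if j = i then p + q else p) * f j) =
    p ^ Suc m * esym (Suc m) S f + q * p ^ m * (f i * esym m (S - {i}) f)"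
proof -
  have "esym r (S - {i}) (\<lambda>j. (if j = i then p + q else p) * f j) = p ^ r * esym r (S - {i}) f" for r
    by (subst esym_scale[symmetric], rule esym_cong) auto
  then show ?thesis
    by (simp add: esym_remove[OF assms] algebra_simps)
qed

text \<open>Expanding the first term along \<open>j\<close> and the second along \<open>i\<close>
  produces the same multiple of \<open>f i * f j\<close> twice, and it cancels. This is the
  subtraction of the equations for two axes.\<close>

lemma esym_remove_diff:
  assumes "finite S" "i \<in> S" "j \<in> S" "i \<noteq> j"
  shows "f i * esym m (S - {i}) f - f j * esym m (S - {j}) f = (f i - f j) * esym m (S - {i, j}) f"
proof (cases m)
  case 0
  then show ?thesis using assms by simp
next
  case (Suc r)
  have "S - {i} - {j} = S - {i, j}" "S - {j} - {i} = S - {i, j}"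
    by auto
  then show ?thesis
    using esym_remove[of "S - {i}" j r f] esym_remove[of "S - {j}" i r f] assms Suc
    by (simp add: algebra_simps)
qed

text \<open>Lists with equal multisets differ by a permutation; composed with an enumeration of
  \<open>S\<close>, it reindexes the sum over list positions. The order in which
  \<open>eigenvalues\<close> lists the roots thus becomes irrelevant.\<close>

lemma elem_sym_eq_esym:
  assumes "finite S" "mset xs = image_mset f (mset_set S)"
  shows "elem_sym j xs = esym j S f"
proof -
  obtain ys where ys: "set ys = S" "distinct ys"
    using assms(1) finite_distinct_list by blast
  then have "mset xs = mset (map f ys)"
    using assms(2) by (metis mset_map mset_set_set)
  then obtain \<pi> where \<pi>: "\<pi> permutes {..<length (map f ys)}" "permute_list \<pi> (map f ys) = xs"
    using mset_eq_permutation by blast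
  have len: "length xs = length ys"
    using \<pi>(2) by auto
  have "bij_betw (\<lambda>i. ys ! \<pi> i) {..<length xs} S"
    using bij_betw_trans[OF permutes_imp_bij[OF \<pi>(1)], of "(!) ys" S] bij_betw_nth[OF ys(2), of "{..<length ys}" S] ys len
    by (simp add: comp_def)
  then have "esym j S f = esym j {..<length xs} (\<lambda>i. f (ys ! \<pi> i))"
    by (rule esym_reindex)
  also have "\<dots> = esym j {..<length xs} ((!) xs)"
  proof (rule esym_cong)
    fix i assume "i \<in> {..<length xs}"
    then have "i < length ys" "\<pi> i < length ys"
      using len permutes_in_image[OF \<pi>(1), of i] by auto
    then show "f (ys ! \<pi> i) = xs ! i"
      using \<pi> permute_list_nth[of \<pi> "map f ys" i] by simp
  qed
  finally show ?thesis
    by (simp add: elem_sym_def esym_def)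
qed

subsection \<open>Characteristic polynomials\<close>

text \<open>Evaluation at \<open>t\<close> is a ring homomorphism and so passes through the signed
  sum over permutations; the signs enter as \<open>of_int\<close>.\<close>

lemma poly_det:
  "poly (det A) t = det (\<chi> i j. poly (A $ i $ j) t)" for A :: "'a::comm_ring_1 poly^'n^'n"
proof -
  have "poly (of_int z) t = of_int z" for z :: int
    by (simp add: of_int_poly)
  then show ?thesis
    by (simp add: det_def poly_sum poly_prod)
qed

lemma poly_charpoly: "poly (charpoly M) t = det (mat t - M)"
  unfolding charpoly_def poly_det
  by (rule arg_cong[of _ _ det]) (simp add: vec_eq_iff mat_def)

lemma charpoly_eqI: "(\<And>t. det (mat t - M) = poly p t) \<Longrightarrow> charpoly M = p"
  by (metis poly_charpoly poly_eq_poly_eq_iff ext)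

text \<open>The scalar matrix \<open>mat t\<close> is fixed by the conjugation, which therefore acts
  on \<open>mat t - M\<close> as a whole and preserves its determinant.\<close>

lemma charpoly_orthogonal_conj:
  assumes "orthogonal_matrix Q"
  shows "charpoly (Q ** M ** transpose Q) = charpoly M"
proof (rule charpoly_eqI)
  fix t
  have Q: "Q ** transpose Q = mat 1"
    using assms by (simp add: orthogonal_matrix_def)
  have "mat t = t *\<^sub>R (mat 1 :: real^'a^'a)"
    by (simp add: mat_def vec_eq_iff)
  then have "mat t = Q ** mat t ** transpose Q"
    using Q by (simp add: matrix_scalar_ac flip: scalar_matrix_assoc)
  moreover have "Q ** (mat t - M) ** transpose Q = Q ** mat t ** transpose Q - Q ** M ** transpose Q"
    by (simp add: matrix_matrix_mult_def vec_eq_iff algebra_simps sum_subtractf)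
  ultimately have "mat t - Q ** M ** transpose Q = Q ** (mat t - M) ** transpose Q"
    by simp
  moreover have "det Q * det (transpose Q) = 1"
    using Q by (metis det_I det_mul)
  ultimately show "det (mat t - Q ** M ** transpose Q) = poly (charpoly M) t"
    by (simp add: det_mul poly_charpoly)
qed

lemma charpoly_diag: "charpoly (diag d) = (\<Prod>i\<in>UNIV. [:- d $ i, 1:])"
proof (rule charpoly_eqI)
  fix t
  have "det (mat t - diag d) = (\<Prod>i\<in>UNIV. (mat t - diag d) $ i $ i)"
    by (rule det_diagonal) (simp add: mat_def diag_def)
  then show "det (mat t - diag d) = poly (\<Prod>i\<in>UNIV. [:- d $ i, 1:]) t"
    by (simp add: poly_prod mat_def diag_def)
qed

text \<open>\<open>eigenvalues\<close> depends on the characteristic polynomial alone, and that of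
  \<open>diag d\<close> has the entries of \<open>d\<close> as its roots with multiplicity.\<close>

lemma elem_sym_eigenvalues_diag:
  fixes d :: "real^'n"
  assumes "charpoly M = charpoly (diag d)"
  shows "elem_sym j (eigenvalues M) = esym j UNIV (($) d)"
proof (rule elem_sym_eq_esym)
  have "proots (charpoly M) = image_mset (($) d) (mset_set UNIV)"
    unfolding assms charpoly_diag by (subst proots_prod) (auto simp: sum_unfold_sum_mset image_mset.compositionality)
  then show "mset (eigenvalues M) = image_mset (($) d) (mset_set UNIV)"
    by (simp add: eigenvalues_def)
qed simp

subsection \<open>Spectral theorem for real symmetric matrices\<close>

lemma symmetric_matrix_inner:
  fixes M :: "real^'n^'n"
  assumes "transpose M = M"
  shows "x \<bullet> (M *v y) = (M *v x) \<bullet> y"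
  by (metis assms dot_lmul_matrix vector_transpose_matrix)

text \<open>First-order condition at a maximum: for small \<open>t\<close> with the sign of
  \<open>b\<close> the linear term would outweigh the quadratic one.\<close>

lemma linear_coeff_0_if_quadratic_bound:
  fixes b c :: real
  assumes "\<And>t. t * b \<le> t^2 * c"
  shows "b = 0"
proof (rule ccontr)
  assume b: "b \<noteq> 0"
  \<comment> \<open>The denominator makes the ratio of \<open>t^2 * c\<close> to
    \<open>t * b\<close> equal to \<open>c / (\<bar>c\<bar> + 1)\<close>, which is less than
    1.\<close>
  define t where "t = b / (\<bar>c\<bar> + 1)"
  have "t * b = b^2 / (\<bar>c\<bar> + 1)"
    by (simp add: t_def power2_eq_square)
  moreover have "t^2 * c = b^2 / (\<bar>c\<bar> + 1) * (c / (\<bar>c\<bar> + 1))"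
    by (simp add: t_def power2_eq_square)
  moreover have "b^2 / (\<bar>c\<bar> + 1) > 0" "c / (\<bar>c\<bar> + 1) < 1"
    using b by (auto simp: divide_simps)
  ultimately show False
    using assms[of t] by (smt (verit) mult_less_cancel_left2)
qed

text \<open>A maximizer \<open>v\<close> of the quadratic form on the unit sphere of
  \<open>V\<close> is an eigenvector, its eigenvalue being the maximum. Invariance of
  \<open>V\<close> keeps \<open>M *v v\<close> among the directions that the first-order condition
  controls.\<close>

lemma symmetric_eigenvector_in_subspace:
  fixes M :: "real^'n^'n"
  assumes sym: "transpose M = M" and V: "subspace V" and inv: "\<And>x. x \<in> V \<Longrightarrow> M *v x \<in> V"
    and ne: "V \<noteq> {0}"
  obtains v c where "v \<in> V" "norm v = 1" "M *v v = c *\<^sub>R v"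
proof -
  define K where "K = V \<inter> sphere 0 1"
  obtain u where u: "u \<in> V" "u \<noteq> 0"
    using ne subspace_0[OF V] by blast
  then have "(1 / norm u) *\<^sub>R u \<in> K"
    by (simp add: K_def subspace_scale[OF V])
  moreover have "compact K"
    unfolding K_def using closed_subspace[OF V] by (simp add: closed_Int_compact)
  moreover have "continuous_on K (\<lambda>x. x \<bullet> (M *v x))"
    by (intro continuous_intros linear_continuous_on) auto
  ultimately obtain v where v: "v \<in> K" and max: "\<And>x. x \<in> K \<Longrightarrow> x \<bullet> (M *v x) \<le> v \<bullet> (M *v v)"
    using continuous_attains_sup[of K "\<lambda>x. x \<bullet> (M *v x)"] by blast
  define c where "c = v \<bullet> (M *v v)"
  have vV: "v \<in> V" and v1: "v \<bullet> v = 1" "norm v = 1"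
    using v by (auto simp: K_def norm_eq_1)
  \<comment> \<open>By homogeneity the maximum over the sphere bounds the form on all of
    \<open>V\<close>.\<close>
  have bound: "x \<bullet> (M *v x) \<le> c * (x \<bullet> x)" if x: "x \<in> V" for x
  proof (cases "x = 0")
    case False
    then have "(1 / norm x) *\<^sub>R x \<in> K"
      using x by (simp add: K_def subspace_scale[OF V])
    from max[OF this] have "(x \<bullet> (M *v x)) / (norm x)^2 \<le> c"
      by (simp add: c_def matrix_vector_mult_scaleR power2_eq_square)
    then show ?thesis
      using False by (simp add: divide_le_eq dot_square_norm)
  qed simp
  have crit: "w \<bullet> (M *v v) = 0" if w: "w \<in> V" "w \<bullet> v = 0" for w
  proof -
    \<comment> \<open>This is \<open>bound\<close> at \<open>v + t *\<^sub>R w\<close>: the terms of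
      order zero cancel, and symmetry of \<open>M\<close> merges the two mixed terms.\<close>
    have "t * (2 * (w \<bullet> (M *v v))) \<le> t^2 * (c * (w \<bullet> w) - w \<bullet> (M *v w))" for t
    proof -
      have "v + t *\<^sub>R w \<in> V"
        using vV w by (simp add: subspace_add[OF V] subspace_scale[OF V])
      from bound[OF this]
      have "c + t * (w \<bullet> (M *v v)) + t * (v \<bullet> (M *v w)) + t * t * (w \<bullet> (M *v w))
          \<le> c * (1 + t * t * (w \<bullet> w))"
        using w v1
        by (simp add: c_def matrix_vector_right_distrib matrix_vector_mult_scaleR inner_add_left
            inner_add_right inner_commute[of v w] algebra_simps)
      moreover have "v \<bullet> (M *v w) = w \<bullet> (M *v v)"
        using symmetric_matrix_inner[OF sym, of v w] by (simp add: inner_commute)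
      ultimately show ?thesis
        by (simp add: power2_eq_square algebra_simps)
    qed
    then have "2 * (w \<bullet> (M *v v)) = 0"
      by (rule linear_coeff_0_if_quadratic_bound)
    then show ?thesis by simp
  qed
  \<comment> \<open>The residual is orthogonal to \<open>v\<close>, and by \<open>crit\<close> also
    to \<open>M *v v\<close>; hence it is orthogonal to itself.\<close>
  define w where "w = M *v v - c *\<^sub>R v"
  have "w \<in> V"
    unfolding w_def using vV inv by (simp add: subspace_diff[OF V] subspace_scale[OF V])
  moreover have wv: "w \<bullet> v = 0"
    using v1 by (simp add: w_def inner_diff_left c_def inner_commute[of "M *v v"])
  ultimately have "w \<bullet> (M *v v) = 0"
    by (rule crit)
  then have "w \<bullet> w = 0"
    using wv by (metis inner_diff_right inner_scaleR_right mult_zero_right right_minus_eq w_def)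
  then show thesis
    using that[of v c] vV v1 by (simp add: w_def)
qed

text \<open>Induction on the dimension: split off an eigenvector \<open>v\<close> and continue in
  its orthogonal complement \<open>W\<close> within \<open>V\<close>. \<open>W\<close> is again
  invariant because v . Mx = Mv . x = c (v . x).\<close>

lemma symmetric_orthonormal_eigenvectors:
  fixes M :: "real^'n^'n"
  assumes sym: "transpose M = M"
  shows "subspace V \<Longrightarrow> (\<And>x. x \<in> V \<Longrightarrow> M *v x \<in> V) \<Longrightarrow>
    \<exists>B. pairwise orthogonal B \<and> span B = V \<and> (\<forall>v\<in>B. norm v = 1 \<and> (\<exists>c. M *v v = c *\<^sub>R v))"
proof (induction "dim V" arbitrary: V rule: less_induct)
  case less
  show ?case
  proof (cases "V = {0}")
    case True
    then show ?thesis
      by (intro exI[of _ "{}"]) auto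
  next
    case False
    obtain v c where v: "v \<in> V" "norm v = 1" "M *v v = c *\<^sub>R v"
      using symmetric_eigenvector_in_subspace[OF sym less.prems False] by blast
    define W where "W = V \<inter> {x. orthogonal v x}"
    have W: "subspace W"
      unfolding W_def by (intro subspace_inter less.prems(1) subspace_orthogonal_to_vector)
    have "v \<notin> W"
      using v(2) by (auto simp: W_def orthogonal_def norm_eq_1)
    then have "W \<subset> V"
      using v(1) by (auto simp: W_def)
    then have "dim W < dim V"
      using dim_psubset W less.prems(1) by (metis span_eq_iff)
    moreover have "M *v x \<in> W" if "x \<in> W" for x
      using that less.prems(2) symmetric_matrix_inner[OF sym, of v x] v(3)
      by (simp add: W_def orthogonal_def)
    ultimately obtain B where B: "pairwise orthogonal B" "span B = W"
        "\<forall>v\<in>B. norm v = 1 \<and> (\<exists>c. M *v v = c *\<^sub>R v)"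
      using less.hyps[of W] W by metis
    have "pairwise orthogonal (insert v B)"
      using B(1) span_superset[of B] B(2) by (auto simp: pairwise_insert W_def orthogonal_commute)
    moreover have "span (insert v B) = V"
    proof (intro equalityI subsetI)
      fix x assume "x \<in> span (insert v B)"
      moreover have "insert v B \<subseteq> V"
        using v(1) span_superset[of B] B(2) by (auto simp: W_def)
      ultimately show "x \<in> V"
        using span_minimal less.prems(1) by blast
    next
      fix x assume x: "x \<in> V"
      have "x - (x \<bullet> v) *\<^sub>R v \<in> W"
        using x v less.prems(1)
        by (simp add: W_def orthogonal_def subspace_diff subspace_scale inner_diff_right norm_eq_1 inner_commute)
      then show "x \<in> span (insert v B)"
        using B(2) by (auto simp: span_insert)
    qed
    ultimately show ?thesis
      using B(3) v by (intro exI[of _ "insert v B"]) auto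
  qed
qed

lemma orthogonal_diagonalization:
  fixes M :: "real^'n^'n"
  assumes sym: "transpose M = M"
  obtains Q d where "orthogonal_matrix Q" "Q ** M ** transpose Q = diag d"
proof -
  obtain B where B: "pairwise orthogonal B" "span B = UNIV"
      "\<forall>v\<in>B. norm v = 1 \<and> (\<exists>c. M *v v = c *\<^sub>R v)"
    using symmetric_orthonormal_eigenvectors[OF sym, of UNIV] by auto
  have "independent B"
    using B by (intro pairwise_orthogonal_independent) auto
  \<comment> \<open>The cardinality allows the basis to be indexed by the coordinate type, as the
    rows of a square matrix must be.\<close>
  then have "card B = CARD('n)"
    using B(2) by (metis dim_UNIV dim_span_eq_card_independent DIM_cart DIM_real mult.right_neutral)
  moreover have "finite B"
    using \<open>independent B\<close> by (rule independent_imp_finite)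
  ultimately obtain f where f: "bij_betw f (UNIV :: 'n set) B"
    by (metis finite_class.finite_UNIV finite_same_card_bij)
  have fB: "f i \<in> B" for i
    using f by (simp add: bij_betw_apply)
  have orth: "f i \<bullet> f j = (if i = j then 1 else 0)" for i j
  proof (cases "i = j")
    case False
    then have "f i \<noteq> f j"
      using f by (metis UNIV_I bij_betw_imp_inj_on inj_on_eq_iff)
    then show ?thesis
      using False B(1) fB by (auto simp: pairwise_def orthogonal_def)
  next
    case True
    have "norm (f i) = 1"
      using fB B(3) by blast
    then show ?thesis
      using True by (simp add: norm_eq_1)
  qed
  have "\<forall>i. \<exists>c. M *v f i = c *\<^sub>R f i"
    using B(3) fB by blast
  from choice[OF this] obtain e where e: "M *v f i = e i *\<^sub>R f i" for i
    by blast
  \<comment> \<open>With the eigenvectors as rows, entry (i, j) of the conjugate is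
    \<open>f i \<bullet> (M *v f j)\<close>.\<close>
  define Q :: "real^'n^'n" where "Q = (\<chi> i. f i)"
  have "orthogonal_matrix Q"
    unfolding orthogonal_matrix_orthonormal_rows
    by (simp add: Q_def row_def norm_eq_1 orthogonal_def orth)
  moreover have "Q ** M ** transpose Q = diag (\<chi> i. e i)"
  proof -
    have "(Q ** M ** transpose Q) $ i $ j = f i \<bullet> (M *v f j)" for i j
      unfolding matrix_mul_assoc[symmetric]
      by (simp add: Q_def matrix_matrix_mult_def matrix_vector_mult_def inner_vec_def transpose_def)
    then show ?thesis
      by (simp add: vec_eq_iff diag_def e orth)
  qed
  ultimately show thesis
    by (rule that)
qed

section \<open>The determinant as the product of the eigenvalues\<close>

lemma det_eq_if_charpoly_eq:
  fixes M N :: "real^'n^'n"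
  assumes "charpoly M = charpoly N"
  shows "det M = det N"
proof -
  \<comment> \<open>The constant coefficient is the determinant up to the sign (-1)^n, which is the
    same for both matrices.\<close>
  have "det (- A) = poly (charpoly A) 0" for A :: "real^'n^'n"
    by (simp add: poly_charpoly)
  then have "det (- M) = det (- N)"
    using assms by simp
  moreover have "det (- A) = (- 1) ^ CARD('n) * det A" for A :: "real^'n^'n"
  proof -
    have "- A = (\<chi> i. (- 1) *s A $ i)"
      by (simp add: vec_eq_iff)
    then show ?thesis
      by (simp only: det_rows_mul vec_lambda_eta prod_constant card_UNIV)
  qed
  ultimately show ?thesis by simp
qed

lemma det_diag: "det (diag d) = (\<Prod>i\<in>UNIV. d $ i)"
  by (subst det_diagonal) (auto simp: diag_def)
  
text \<open>Diagonalization supplies a full list of real eigenvalues with product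
  \<open>det M\<close>. In the case (k, l) = (n, 0) the equation thereby concerns a determinant,
  which is multiplicative.\<close>

lemma elem_sym_eigenvalues_det:
  fixes M :: "real^'n^'n"
  assumes "transpose M = M"
  shows "elem_sym CARD('n) (eigenvalues M) = det M"
proof -
  obtain Q d where Q: "orthogonal_matrix Q" "Q ** M ** transpose Q = diag d"
    using orthogonal_diagonalization[OF assms] .
  have "charpoly M = charpoly (diag d)"
    using charpoly_orthogonal_conj[OF Q(1), of M] Q(2) by simp
  then have "elem_sym CARD('n) (eigenvalues M) = prod (($) d) UNIV"
    by (simp add: elem_sym_eigenvalues_diag esym_card)
  also have "\<dots> = det M"
    using \<open>charpoly M = charpoly (diag d)\<close> by (metis det_diag det_eq_if_charpoly_eq)
  finally show ?thesis .
qed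

subsection \<open>Rank one perturbations\<close>

definition outer :: "real^'n \<Rightarrow> real^'n^'n" where
  "outer y = (\<chi> i j. y $ i * y $ j)"

lemma outer_conj: "Q ** outer y ** transpose Q = outer (Q *v y)"
proof -
  have "(Q ** outer y ** transpose Q) $ i $ j = outer (Q *v y) $ i $ j" for i j
  proof -
    have "(\<Sum>u\<in>UNIV. Q $ i $ u * (y $ u * y $ t)) = (\<Sum>u\<in>UNIV. Q $ i $ u * y $ u) * y $ t" for t
      by (simp add: sum_distrib_right mult.assoc)
    then show ?thesis
      by (simp add: matrix_matrix_mult_def matrix_vector_mult_def outer_def transpose_def
          sum_distrib_left mult.assoc mult.commute[of "Q $ j $ _"])
  qed
  then show ?thesis
    by (simp add: vec_eq_iff)
qed

text \<open>An orthogonal matrix that turns \<open>y\<close> onto the \<open>i\<close>-th axis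
  diagonalizes the rank one term and leaves the scalar term as it is.\<close>

lemma scaled_identity_plus_outer_conj:
  fixes y :: "real^'n" and i :: 'n
  obtains Q where "orthogonal_matrix Q"
    "Q ** (mat p + q *\<^sub>R outer y) ** transpose Q = diag (\<chi> j. if j = i then p + q * (y \<bullet> y) else p)"
proof -
  \<comment> \<open>Scaling the axis vector by \<open>norm y\<close> lets the claim include
    \<open>y = 0\<close>, where there is no direction to normalize.\<close>
  have "\<exists>A. orthogonal_matrix A \<and> A *v (norm y *\<^sub>R axis i 1) = y"
  proof (cases "y = 0")
    case True
    then show ?thesis
      by (intro exI[of _ "mat 1"]) (simp add: orthogonal_matrix_id)
  next
    case False
    then have "norm ((1 / norm y) *\<^sub>R y) = 1" by simp
    then obtain A where "orthogonal_matrix A" "A *v axis i 1 = (1 / norm y) *\<^sub>R y"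
      using orthogonal_matrix_exists_basis by metis
    then show ?thesis
      using False by (intro exI[of _ A]) (simp add: matrix_vector_mult_scaleR)
  qed
  then obtain A where A: "orthogonal_matrix A" "A *v (norm y *\<^sub>R axis i 1) = y"
    by blast
  define Q where "Q = transpose A"
  have Q: "orthogonal_matrix Q" "Q ** transpose Q = mat 1"
    using A(1) by (simp_all add: Q_def orthogonal_matrix_def)
  have Qy: "Q *v y = norm y *\<^sub>R axis i 1"
    using A by (metis Q_def matrix_vector_mul_assoc matrix_vector_mul_lid orthogonal_matrix_def)
  have "mat p = p *\<^sub>R (mat 1 :: real^'n^'n)"
    by (simp add: mat_def vec_eq_iff)
  then have "Q ** mat p ** transpose Q = mat p"
    using Q(2) by (simp add: matrix_scalar_ac flip: scalar_matrix_assoc)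
  moreover have "Q ** (q *\<^sub>R outer y) ** transpose Q = q *\<^sub>R outer (norm y *\<^sub>R axis i 1)"
    by (simp add: matrix_scalar_ac outer_conj Qy flip: scalar_matrix_assoc)
  moreover have "Q ** (mat p + q *\<^sub>R outer y) ** transpose Q =
      Q ** mat p ** transpose Q + Q ** (q *\<^sub>R outer y) ** transpose Q"
    by (simp add: matrix_matrix_mult_def vec_eq_iff algebra_simps sum.distrib)
  moreover have "mat p + q *\<^sub>R outer (norm y *\<^sub>R axis i 1) = diag (\<chi> j. if j = i then p + q * (y \<bullet> y) else p)"
    by (auto simp: vec_eq_iff mat_def outer_def diag_def axis_def dot_square_norm power2_eq_square)
  ultimately have "Q ** (mat p + q *\<^sub>R outer y) ** transpose Q = diag (\<chi> j. if j = i then p + q * (y \<bullet> y) else p)"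
    by simp
  with Q(1) show thesis by (rule that)
qed

lemma charpoly_scaled_identity_plus_outer:
  fixes y :: "real^'n" and i :: 'n
  shows "charpoly (mat p + q *\<^sub>R outer y) = charpoly (diag (\<chi> j. if j = i then p + q * (y \<bullet> y) else p))"
proof -
  obtain Q where "orthogonal_matrix Q"
    "Q ** (mat p + q *\<^sub>R outer y) ** transpose Q = diag (\<chi> j. if j = i then p + q * (y \<bullet> y) else p)"
    using scaled_identity_plus_outer_conj .
  then show ?thesis
    using charpoly_orthogonal_conj by metis
qed

subsection \<open>Hessians of generalized symmetric functions\<close>

definition quad :: "real^'n \<Rightarrow> real^'n \<Rightarrow> real" where
  "quad a x = 1/2 * (\<Sum>i\<in>UNIV. a $ i * (x $ i)\<^sup>2)"

text \<open>The Hessian of w(\<open>quad a x\<close>) when \<open>p\<close> and \<open>q\<close> are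
  the values of w' and w'' at \<open>quad a x\<close>. As free reals they separate the linear
  algebra from the calculus.\<close>

definition radial_hessian :: "real \<Rightarrow> real \<Rightarrow> real^'n \<Rightarrow> real^'n \<Rightarrow> real^'n^'n" where
  "radial_hessian p q a x = p *\<^sub>R diag a + q *\<^sub>R outer (\<chi> i. a $ i * x $ i)"

lemma elem_sym_0: "elem_sym 0 xs = 1"
  using esym_0[of "{..<length xs}"] by (simp add: elem_sym_def esym_def)

lemma has_derivative_quad:
  "(quad a has_derivative (\<lambda>h. \<Sum>i\<in>UNIV. a $ i * x $ i * h $ i)) (at x)"
  unfolding quad_def
  by (auto intro!: derivative_eq_intros bounded_linear.has_derivative[OF bounded_linear_vec_nth]
      simp: fun_eq_iff sum_distrib_left intro!: sum.cong)

lemma continuous_on_quad [continuous_intros]: "continuous_on S (quad a)"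
  by (meson has_derivative_quad continuous_at_imp_continuous_on has_derivative_continuous)

lemma has_derivative_radial:
  assumes "(w has_real_derivative p) (at (quad a x))"
  shows "((\<lambda>x. w (quad a x)) has_derivative (\<lambda>h. p * (\<Sum>i\<in>UNIV. a $ i * x $ i * h $ i))) (at x)"
  using has_derivative_compose[OF has_derivative_quad, of w "(*) p"] assms
  by (simp add: has_field_derivative_def)

lemma gradient_radial:
  assumes "(w has_real_derivative p) (at (quad a x))"
  shows "gradient (\<lambda>x. w (quad a x)) x = (\<chi> i. p * (a $ i * x $ i))"
proof -
  have "frechet_derivative (\<lambda>x. w (quad a x)) (at x) = (\<lambda>h. p * (\<Sum>i\<in>UNIV. a $ i * x $ i * h $ i))"
    using has_derivative_radial[OF assms] by (rule frechet_derivative_at[symmetric])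
  then show ?thesis
    by (simp add: gradient_def axis_def vec_eq_iff if_distrib cong: if_cong)
qed

text \<open>The closed form of the gradient is available where \<open>quad a\<close> takes values in
  \<open>I\<close>. That set is an open neighbourhood of \<open>x\<close>, so the product rule may
  be applied to the closed form there.\<close>

lemma has_derivative_gradient_radial:
  assumes "open I" "\<And>s. s \<in> I \<Longrightarrow> (w has_real_derivative p s) (at s)"
    and "\<And>s. s \<in> I \<Longrightarrow> (p has_real_derivative q s) (at s)" and "quad a x \<in> I"
  shows "(gradient (\<lambda>x. w (quad a x)) has_derivative
    (\<lambda>h. radial_hessian (p (quad a x)) (q (quad a x)) a x *v h)) (at x)"
proof (rule has_derivative_transform_within_open)
  show "open (quad a -` I)"
    using assms(1) continuous_on_quad by (metis continuous_on_open_vimage open_UNIV Int_UNIV_right)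
  show "(\<chi> i. p (quad a y) * (a $ i * y $ i)) = gradient (\<lambda>x. w (quad a x)) y" if "y \<in> quad a -` I" for y
    using that assms(2) by (intro gradient_radial[symmetric]) auto
  have "((\<lambda>y. p (quad a y) * (a $ i * y $ i)) has_derivative
      (\<lambda>h. (radial_hessian (p (quad a x)) (q (quad a x)) a x *v h) $ i)) (at x)" for i
  proof -
    have "((\<lambda>y. p (quad a y)) has_derivative (\<lambda>h. q (quad a x) * (\<Sum>i\<in>UNIV. a $ i * x $ i * h $ i))) (at x)"
      using assms(3,4) by (intro has_derivative_radial)
    moreover have "((\<lambda>y. a $ i * y $ i) has_derivative (\<lambda>h. a $ i * h $ i)) (at x)"
      by (intro bounded_linear_imp_has_derivative bounded_linear_const_mult bounded_linear_vec_nth)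
    ultimately have "((\<lambda>y. p (quad a y) * (a $ i * y $ i)) has_derivative
      (\<lambda>h. p (quad a x) * (a $ i * h $ i) + q (quad a x) * (\<Sum>i\<in>UNIV. a $ i * x $ i * h $ i) * (a $ i * x $ i))) (at x)"
      by (rule has_derivative_mult)
    moreover have "(radial_hessian (p (quad a x)) (q (quad a x)) a x *v h) $ i =
      p (quad a x) * (a $ i * h $ i) + q (quad a x) * (\<Sum>i\<in>UNIV. a $ i * x $ i * h $ i) * (a $ i * x $ i)" for h
    proof -
      have "(outer (\<chi> i. a $ i * x $ i) *v h) $ i = (\<Sum>j\<in>UNIV. a $ j * x $ j * h $ j) * (a $ i * x $ i)"
        by (simp add: outer_def matrix_vector_mult_def sum_distrib_left sum_distrib_right mult_ac)
      moreover have "(diag a *v h) $ i = a $ i * h $ i"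
        by (simp add: diag_def matrix_vector_mult_def if_distrib[of "\<lambda>z. z * _"] cong: if_cong)
      ultimately show ?thesis
        by (simp add: radial_hessian_def matrix_vector_mult_add_rdistrib flip: scaleR_matrix_vector_assoc)
    qed
    ultimately show ?thesis by simp
  qed
  then show "((\<lambda>y. \<chi> i. p (quad a y) * (a $ i * y $ i)) has_derivative
      (\<lambda>h. radial_hessian (p (quad a x)) (q (quad a x)) a x *v h)) (at x)"
    unfolding has_derivative_componentwise_within[where f = "\<lambda>y. \<chi> i. p (quad a y) * (a $ i * y $ i)"]
    by (auto simp: Basis_vec_def inner_axis)
qed (use assms(4) in auto)

lemma hessian_radial:
  assumes "open I" "\<And>s. s \<in> I \<Longrightarrow> (w has_real_derivative p s) (at s)"
    and "\<And>s. s \<in> I \<Longrightarrow> (p has_real_derivative q s) (at s)" and "quad a x \<in> I"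
  shows "hessian (\<lambda>x. w (quad a x)) x = radial_hessian (p (quad a x)) (q (quad a x)) a x"
proof -
  have "frechet_derivative (gradient (\<lambda>x. w (quad a x))) (at x) =
      (*v) (radial_hessian (p (quad a x)) (q (quad a x)) a x)"
    using has_derivative_gradient_radial[OF assms] by (rule frechet_derivative_at[symmetric])
  then show ?thesis
    by (simp add: hessian_def jacobian_def)
qed

lemma C2_on_radial:
  assumes "open I" "\<And>s. s \<in> I \<Longrightarrow> (w has_real_derivative p s) (at s)"
    and "\<And>s. s \<in> I \<Longrightarrow> (p has_real_derivative q s) (at s)" and "continuous_on I q"
    and "\<And>x. x \<in> S \<Longrightarrow> quad a x \<in> I"
  shows "C2_on S (\<lambda>x. w (quad a x))"
proof -
  have "(\<lambda>x. w (quad a x)) differentiable at x" if "x \<in> S" for x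
    using has_derivative_radial[OF assms(2)[OF assms(5)[OF that]]] unfolding differentiable_def by blast
  moreover have "gradient (\<lambda>x. w (quad a x)) differentiable at x" if "x \<in> S" for x
    using has_derivative_gradient_radial[OF assms(1-3) assms(5)[OF that]] unfolding differentiable_def by blast
  moreover have "continuous_on S (hessian (\<lambda>x. w (quad a x)))"
  proof -
    have "continuous_on I p"
      by (intro continuous_at_imp_continuous_on ballI DERIV_isCont[OF assms(3)])
    then have "continuous_on S (\<lambda>x. p (quad a x))" "continuous_on S (\<lambda>x. q (quad a x))"
      using assms(4,5) by (auto intro!: continuous_on_compose2[OF _ continuous_on_quad])
    then have "continuous_on S (\<lambda>x. radial_hessian (p (quad a x)) (q (quad a x)) a x)"
      unfolding radial_hessian_def outer_def by (intro continuous_intros; simp; intro continuous_intros)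
    then show ?thesis
      by (subst continuous_on_cong[OF refl hessian_radial[OF assms(1-3) assms(5)]])
  qed
  ultimately show ?thesis
    unfolding C2_on_def by (auto intro: differentiable_at_imp_differentiable_on)
qed

section \<open>Elementary symmetric functions of the radial Hessian\<close>

lemma quad_axis: "2 * quad a (axis i r) = a $ i * r^2"
  by (simp add: quad_def axis_def if_distrib[of "\<lambda>z. z^2"] if_distrib[of "\<lambda>z. _ * z"] cong: if_cong)

text \<open>On the axis the outer product has the single entry \<open>(a $ i * r)^2\<close>, which
  equals \<open>2 * quad a (axis i r) * a $ i\<close>.\<close>

lemma elem_sym_radial_hessian_axis:
  "elem_sym j (eigenvalues (radial_hessian p q a (axis i r))) =
    esym j UNIV (\<lambda>m. (if m = i then p + 2 * quad a (axis i r) * q else p) * a $ m)"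
proof -
  have "radial_hessian p q a (axis i r) =
      diag (\<chi> m. (if m = i then p + 2 * quad a (axis i r) * q else p) * a $ m)"
    unfolding quad_axis by (auto simp: radial_hessian_def diag_def outer_def axis_def vec_eq_iff power2_eq_square algebra_simps)
  then show ?thesis
    by (simp add: elem_sym_eigenvalues_diag vec_lambda_inverse)
qed

text \<open>For scalar \<open>diag a\<close> the Hessian is a multiple of the identity plus a rank
  one term, and \<open>c * (x \<bullet> x)\<close> is \<open>2 * quad a x\<close>. The right side is
  the value at a point of the \<open>i\<close>-th axis on the same level set.\<close>

lemma elem_sym_radial_hessian_const:
  fixes a x :: "real^'n"
  assumes "\<And>m. a $ m = c"
  shows "elem_sym j (eigenvalues (radial_hessian p q a x)) =
    esym j UNIV (\<lambda>m. (if m = i then p + 2 * quad a x * q else p) * a $ m)"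
proof -
  have "radial_hessian p q a x = mat (p * c) + (q * c^2) *\<^sub>R outer x"
    by (simp add: radial_hessian_def diag_def outer_def mat_def assms vec_eq_iff power2_eq_square)
  moreover have "(\<chi> m. if m = i then p * c + q * c^2 * (x \<bullet> x) else p * c) =
      (\<chi> m. (if m = i then p + 2 * quad a x * q else p) * a $ m)"
    by (simp add: vec_eq_iff assms quad_def inner_vec_def power2_eq_square sum_distrib_left algebra_simps)
  ultimately have "charpoly (radial_hessian p q a x) =
      charpoly (diag (\<chi> m. (if m = i then p + 2 * quad a x * q else p) * a $ m))"
    using charpoly_scaled_identity_plus_outer[of "p * c" "q * c^2" x i] by simp
  then show ?thesis
    by (simp add: elem_sym_eigenvalues_diag vec_lambda_inverse)
qed

text \<open>Factoring out the square root of \<open>diag a\<close> on both sides changes the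
  eigenvalues but multiplies the determinant by a known factor; hence the restriction to the index
  \<open>CARD('n)\<close>.\<close>

lemma elem_sym_radial_hessian_full:
  fixes a x :: "real^'n"
  assumes "\<And>m. a $ m > 0"
  shows "elem_sym CARD('n) (eigenvalues (radial_hessian p q a x)) =
    esym CARD('n) UNIV (\<lambda>m. (if m = i then p + 2 * quad a x * q else p) * a $ m)"
proof -
  define r where "r = (\<chi> m. sqrt (a $ m))"
  \<comment> \<open>In these coordinates the level sets become spheres: \<open>y \<bullet> y\<close>
    is \<open>2 * quad a x\<close>.\<close>
  define y where "y = (\<chi> m. r $ m * x $ m)"
  have rr: "r $ m * r $ m = a $ m" for m
    using assms[of m] by (simp add: r_def)
  have "transpose (radial_hessian p q a x) = radial_hessian p q a x"
    by (auto simp: radial_hessian_def diag_def outer_def transpose_def vec_eq_iff)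
  then have "elem_sym CARD('n) (eigenvalues (radial_hessian p q a x)) = det (radial_hessian p q a x)"
    by (rule elem_sym_eigenvalues_det)
  also have "det (radial_hessian p q a x) = det (diag r ** (mat p + q *\<^sub>R outer y) ** diag r)"
  proof -
    have "(diag r ** (mat p + q *\<^sub>R outer y) ** diag r) $ u $ v = r $ u * (mat p + q *\<^sub>R outer y) $ u $ v * r $ v" for u v
      by (simp add: matrix_matrix_mult_def diag_def if_distrib[of "\<lambda>z. z * _"] if_distrib[of "\<lambda>z. _ * z"] cong: if_cong)
    moreover have "radial_hessian p q a x $ u $ v = r $ u * (mat p + q *\<^sub>R outer y) $ u $ v * r $ v" for u v
      using rr[of u] rr[of v]
      by (simp add: radial_hessian_def y_def outer_def diag_def mat_def algebra_simps flip: rr)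
    ultimately have "radial_hessian p q a x = diag r ** (mat p + q *\<^sub>R outer y) ** diag r"
      by (simp add: vec_eq_iff)
    then show ?thesis by simp
  qed
  also have "\<dots> = det (diag r) * det (diag r) * det (mat p + q *\<^sub>R outer y)"
    by (simp add: det_mul)
  also have "det (mat p + q *\<^sub>R outer y) = det (diag (\<chi> m. if m = i then p + q * (y \<bullet> y) else p))"
    by (rule det_eq_if_charpoly_eq) (rule charpoly_scaled_identity_plus_outer)
  also have "q * (y \<bullet> y) = 2 * quad a x * q"
    by (simp add: y_def quad_def inner_vec_def power2_eq_square mult_ac flip: rr)
  also have "det (diag r) * det (diag r) = (\<Prod>m\<in>UNIV. a $ m)"
    by (simp add: det_diag rr flip: prod.distrib)
  finally show ?thesis
    by (simp add: esym_card det_diag prod.distrib mult_ac)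
qed

subsection \<open>The ordinary differential equation\<close>

text \<open>The expression is the derivative of G(p) = p^k - p^l. For \<open>l = 0\<close> the
  truncated exponent \<open>l - 1\<close> does no harm, since its term has the factor 0.\<close>

lemma power_diff_deriv_pos:
  fixes p :: real
  assumes "l < k" "p \<ge> 1"
  shows "real k * p ^ (k - 1) - real l * p ^ (l - 1) > 0"
proof -
  have "real l * p ^ (l - 1) \<le> real l * p ^ (k - 1)"
    using assms by (intro mult_left_mono power_increasing) auto
  also have "\<dots> < real k * p ^ (k - 1)"
    using assms by simp
  finally show ?thesis by simp
qed

text \<open>\<open>H\<close> inverts G(p) = p^k - p^l on the branch p > 1, where G increases
  strictly from G(1) = 0 and is unbounded.\<close>

lemma power_diff_inverse:
  assumes "l < k"
  obtains H :: "real \<Rightarrow> real" where "\<And>y. y > 0 \<Longrightarrow> H y > 1" "\<And>y. y > 0 \<Longrightarrow> H y ^ k - H y ^ l = y"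
    "\<And>y. y > 0 \<Longrightarrow>
      (H has_real_derivative inverse (real k * H y ^ (k - 1) - real l * H y ^ (l - 1))) (at y)"
proof -
  define G :: "real \<Rightarrow> real" where "G = (\<lambda>p. p ^ k - p ^ l)"
  define G' :: "real \<Rightarrow> real" where "G' = (\<lambda>p. real k * p ^ (k - 1) - real l * p ^ (l - 1))"
  have G': "(G has_real_derivative G' p) (at p)" for p
    unfolding G_def G'_def by (auto intro!: derivative_eq_intros)
  have contG: "continuous_on S G" for S
    unfolding G_def by (intro continuous_intros)
  have mono: "G x < G y" if "1 \<le> x" "x < y" for x y
    using that power_diff_deriv_pos[OF assms] G'
    by (intro DERIV_pos_imp_increasing[OF \<open>x < y\<close>]) (force simp: G'_def)
  have ex: "\<exists>p. p > 1 \<and> G p = y" if y: "y > 0" for y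
  proof -
    \<comment> \<open>The point 1 + y bounds the search for a preimage: G(1 + y) = (1 + y)^l ((1 +
      y)^(k-l) - 1) is at least y.\<close>
    have "1 + y \<le> (1 + y) ^ (k - l)"
      using y assms by (intro self_le_power) auto
    then have "1 * y \<le> (1 + y) ^ l * ((1 + y) ^ (k - l) - 1)"
      using y by (intro mult_mono one_le_power) auto
    also have "\<dots> = G (1 + y)"
      using assms by (simp add: G_def algebra_simps flip: power_add)
    finally have "y \<le> G (1 + y)" by simp
    then obtain p where "1 \<le> p" "G p = y"
      using IVT'[of G 1 y "1 + y"] y contG by (auto simp: G_def)
    moreover have "p \<noteq> 1"
      using \<open>G p = y\<close> y by (auto simp: G_def)
    ultimately show ?thesis by (intro exI[of _ p]) simp
  qed
  define H where "H = (\<lambda>y. SOME p. p > 1 \<and> G p = y)"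
  have H: "H y > 1" "G (H y) = y" if "y > 0" for y
    using someI_ex[OF ex[OF that]] by (simp_all add: H_def)
  have HG: "H (G z) = z" if "z > 1" for z
  proof -
    have "G z > 0"
      using mono[of 1 z] that by (simp add: G_def)
    from H[OF this] show ?thesis
      using mono[of z "H (G z)"] mono[of "H (G z)" z] that by (cases z "H (G z)" rule: linorder_cases) auto
  qed
  have "(H has_real_derivative inverse (G' (H y))) (at y)" if "y > 0" for y
  proof -
    have "G' (H y) > 0"
      using power_diff_deriv_pos[OF assms] H(1)[OF that] by (simp add: G'_def)
    then show ?thesis
      unfolding has_field_derivative_def
      using H[OF that] contG HG G'[of "H y", unfolded has_field_derivative_def]
      by (intro has_derivative_inverse_strong_x[of "{1<..}" H y G "(*) (G' (H y))"]) (auto simp: fun_eq_iff)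
  qed
  with H that[of H] show thesis
    by (simp add: G_def G'_def)
qed

text \<open>For y = G(w') the equation reads n y + 2 s y' = 0, which y = s^(-n/2) solves; inverting
  G gives w', and an antiderivative gives w. The signs of \<open>p\<close> and \<open>q\<close>
  later ensure that the denominator does not vanish.\<close>

lemma radial_ode_solution:
  fixes \<alpha> \<beta> :: real
  assumes "l < k" "0 < n" "0 < \<alpha>"
  obtains w p q :: "real \<Rightarrow> real" where
    "\<And>s. s \<in> {\<alpha><..<\<beta>} \<Longrightarrow> (w has_real_derivative p s) (at s)"
    "\<And>s. s \<in> {\<alpha><..<\<beta>} \<Longrightarrow> (p has_real_derivative q s) (at s)"
    "continuous_on {\<alpha><..<\<beta>} q"
    "\<And>s. s \<in> {\<alpha><..<\<beta>} \<Longrightarrow> p s > 0" "\<And>s. s \<in> {\<alpha><..<\<beta>} \<Longrightarrow> q s < 0"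
    "\<And>s. s \<in> {\<alpha><..<\<beta>} \<Longrightarrow> real n * (p s ^ k - p s ^ l) +
        2 * s * q s * (real k * p s ^ (k - 1) - real l * p s ^ (l - 1)) = 0"
proof -
  obtain H :: "real \<Rightarrow> real" where H: "\<And>y. y > 0 \<Longrightarrow> H y > 1" "\<And>y. y > 0 \<Longrightarrow> H y ^ k - H y ^ l = y"
    "\<And>y. y > 0 \<Longrightarrow>
      (H has_real_derivative inverse (real k * H y ^ (k - 1) - real l * H y ^ (l - 1))) (at y)"
    by (rule power_diff_inverse[OF assms(1)]) blast
  define e where "e = - real n / 2"
  define p where "p = (\<lambda>s. H (s powr e))"
  define D where "D = (\<lambda>s. real k * p s ^ (k - 1) - real l * p s ^ (l - 1))"
  define q where "q = (\<lambda>s. inverse (D s) * (e * s powr (e - 1)))"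
  have p1: "p s > 1" and pG: "p s ^ k - p s ^ l = s powr e" if "s > 0" for s
    using H(1,2)[of "s powr e"] that by (simp_all add: p_def)
  have D: "D s > 0" if "s > 0" for s
    using power_diff_deriv_pos[OF assms(1), of "p s"] p1[OF that] by (simp add: D_def)
  have dp: "(p has_real_derivative q s) (at s)" if "s > 0" for s
    using DERIV_chain2[OF H(3)[of "s powr e"] has_real_derivative_powr[OF that, of e]] that
    by (simp add: p_def[abs_def] q_def D_def)
  have contp: "continuous_on S p" if "S \<subseteq> {0<..}" for S
    using that by (intro continuous_at_imp_continuous_on ballI DERIV_isCont[OF dp]) auto
  have q0: "q s < 0" if "s > 0" for s
    using D[OF that] assms(2) that by (simp add: q_def e_def mult_pos_neg divide_neg_pos mult_neg_pos)
  have contq: "continuous_on {\<alpha><..<\<beta>} q"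
  proof -
    have "{\<alpha><..<\<beta>} \<subseteq> {0<..}"
      using assms(3) by auto
    moreover have "D s \<noteq> 0" if "s \<in> {\<alpha><..<\<beta>}" for s
      using D[of s] that assms(3) by simp
    moreover have "s \<noteq> 0" if "s \<in> {\<alpha><..<\<beta>}" for s
      using that assms(3) by simp
    ultimately show ?thesis
      unfolding q_def D_def by (intro continuous_intros contp ballI) auto
  qed
  \<comment> \<open>Since \<alpha> > 0, the formula for \<open>p\<close> stays continuous up to the
    endpoints, and an antiderivative exists on the closed interval.\<close>
  have "continuous_on {\<alpha>..\<beta>} p"
    using assms(3) by (intro contp) auto
  then obtain w where w: "\<And>s. s \<in> {\<alpha>..\<beta>} \<Longrightarrow> (w has_vector_derivative p s) (at s within {\<alpha>..\<beta>})"
    using antiderivative_continuous by blast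
  have dw: "(w has_real_derivative p s) (at s)" if "s \<in> {\<alpha><..<\<beta>}" for s
    using w[of s] that by (simp add: at_within_Icc_at has_real_derivative_iff_has_vector_derivative)
  have ode: "real n * (p s ^ k - p s ^ l) + 2 * s * q s * (real k * p s ^ (k - 1) - real l * p s ^ (l - 1)) = 0"
    if "s > 0" for s
  proof -
    have "q s * D s = e * s powr (e - 1)"
      using D[OF that] by (simp add: q_def)
    moreover have "s * s powr (e - 1) = s powr e"
      using that by (simp add: powr_diff)
    ultimately have "2 * s * (q s * D s) = 2 * e * s powr e"
      by (simp add: mult.left_commute)
    then show ?thesis
      using pG[OF that] by (simp add: D_def e_def mult.assoc)
  qed
  show thesis
    using that[of w p q] dw dp contq ode p1 q0 assms(3) by (smt (verit) greaterThanLessThan_iff)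
qed

subsection \<open>Rigidity and existence\<close>

text \<open>Here \<open>p\<close> is w' and \<open>t\<close> is 2 s w''. The constant
  \<open>c\<close> is fixed before \<open>p\<close> and \<open>t\<close>, so the conclusion holds
  with one value for all level sets with w'' nonzero.\<close>

lemma pointwise_rigidity:
  fixes a :: "'a::finite \<Rightarrow> real"
  assumes "l < k" "k \<le> CARD('a)" "\<not> (l = 0 \<and> k = CARD('a))"
    and a: "\<And>i. a i > 0" and "a i \<noteq> a j"
  obtains c where "\<And>p t. t \<noteq> 0 \<Longrightarrow>
    (\<And>i. esym k UNIV (\<lambda>m. (if m = i then p + t else p) * a m) =
      esym l UNIV (\<lambda>m. (if m = i then p + t else p) * a m)) \<Longrightarrow>
    (\<And>i. esym k UNIV (\<lambda>m. (if m = i then p + t else p) * a m) \<noteq> 0) \<Longrightarrow> p \<noteq> 0 \<and> p ^ (k - l) = c"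
proof -
  define T where "T = UNIV - {i, j}"
  define c where "c = (if l = 0 then 0 else esym (l - 1) T a / esym (k - 1) T a)"
  have ij: "i \<noteq> j" using assms(5) by auto
  then have cardT: "card T = CARD('a) - 2"
    by (simp add: T_def card_Diff_subset)
  have card2: "CARD('a) \<ge> 2"
    using card_mono[of UNIV "{i, j}"] ij by simp
  obtain k' where k: "k = Suc k'"
    using assms(1) by (cases k) auto
  have "p \<noteq> 0 \<and> p ^ (k - l) = c"
    if t: "t \<noteq> 0"
      and eq: "\<And>i. esym k UNIV (\<lambda>m. (if m = i then p + t else p) * a m) =
        esym l UNIV (\<lambda>m. (if m = i then p + t else p) * a m)"
      and nz: "\<And>i. esym k UNIV (\<lambda>m. (if m = i then p + t else p) * a m) \<noteq> 0" for p t
  proof -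
    have diff: "esym (Suc m) UNIV (\<lambda>m. (if m = i then p + t else p) * a m) -
        esym (Suc m) UNIV (\<lambda>m. (if m = j then p + t else p) * a m) = t * (a i - a j) * (p ^ m * esym m T a)" for m
    proof -
      have "esym (Suc m) UNIV (\<lambda>m. (if m = i then p + t else p) * a m) -
          esym (Suc m) UNIV (\<lambda>m. (if m = j then p + t else p) * a m) =
          t * p ^ m * (a i * esym m (UNIV - {i}) a - a j * esym m (UNIV - {j}) a)"
        by (simp only: esym_scale_except finite UNIV_I right_diff_distrib)
      then show ?thesis
        using esym_remove_diff[of UNIV i j a m] ij by (simp add: T_def)
    qed
    \<comment> \<open>The equations for the axes \<open>i\<close> and \<open>j\<close> are
      subtracted and divided by \<open>t * (a i - a j)\<close>. For \<open>l = 0\<close> both right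
      sides are 1 and cancel.\<close>
    have bal: "p ^ k' * esym k' T a = (if l = 0 then 0 else p ^ (l - 1) * esym (l - 1) T a)"
    proof (cases l)
      case 0
      then show ?thesis
        using diff[of k'] eq[of i] eq[of j] t assms(5) by (simp add: k)
    next
      case (Suc l')
      then have "t * (a i - a j) * (p ^ k' * esym k' T a) = t * (a i - a j) * (p ^ l' * esym l' T a)"
        using diff[of k'] diff[of l'] eq[of i] eq[of j] unfolding k Suc by linarith
      then show ?thesis
        using t assms(5) Suc by simp
    qed
    \<comment> \<open>If \<open>p = 0\<close>, the values on the axes vanish for
      \<open>k \<ge> 2\<close>, against \<open>nz\<close>; for \<open>k = 1\<close> the balance
      \<open>bal\<close> would read 1 = 0.\<close>
    have p: "p \<noteq> 0"
    proof
      assume "p = 0"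
      show False
      proof (cases k')
        case 0
        then show False
          using bal assms(1) by (simp add: k T_def)
      next
        case (Suc r)
        then show False
          using nz[of i] \<open>p = 0\<close> by (simp add: k esym_scale_except)
      qed
    qed
    have pos: "esym m T a > 0" if "m \<le> CARD('a) - 2" for m
      using that a cardT by (intro esym_pos) (auto simp: T_def)
    show ?thesis
    proof (cases l)
      case 0
      then have "esym k' T a > 0"
        using assms(2,3) by (intro pos) (simp add: k)
      then show ?thesis
        using bal 0 p by simp
    next
      case (Suc l')
      then have "esym l' T a > 0"
        using assms(1,2) by (intro pos) (simp add: k)
      have "p ^ k' = p ^ l' * p ^ (k - l)"
        using Suc assms(1) by (simp add: k flip: power_add)
      then have "p ^ (k - l) * esym k' T a = esym l' T a"
        using bal p Suc by simp
      \<comment> \<open>For \<open>k = CARD('a)\<close> the set \<open>T\<close> has fewer than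
        \<open>k'\<close> elements, so this comes from the equation with its positive right side and
        not from \<open>pos\<close>.\<close>
      moreover have "esym k' T a \<noteq> 0"
        using calculation \<open>esym l' T a > 0\<close> by auto
      ultimately show ?thesis
        using p Suc by (simp add: c_def k nonzero_eq_divide_eq)
    qed
  qed
  then show thesis
    by (rule that)
qed

text \<open>By continuity \<open>q\<close> is nonzero near \<open>s\<close>, so \<open>p ^ m\<close>
  is constant there; yet its derivative m p^(m-1) q at \<open>s\<close> is nonzero.\<close>

lemma power_not_locally_constant:
  fixes p q :: "real \<Rightarrow> real"
  assumes "open I" "s \<in> I" "\<And>s. s \<in> I \<Longrightarrow> (p has_real_derivative q s) (at s)" "continuous_on I q"
    and "q s \<noteq> 0" "m > 0" and "\<And>s. s \<in> I \<Longrightarrow> q s \<noteq> 0 \<Longrightarrow> p s \<noteq> 0 \<and> p s ^ m = c"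
  shows False
proof -
  define J where "J = I \<inter> q -` (- {0})"
  have J: "open J" "s \<in> J"
    using assms(2,5) continuous_open_preimage[OF assms(4,1), of "- {0}"] by (auto simp: J_def)
  have "((\<lambda>s. p s ^ m) has_real_derivative real m * p s ^ (m - 1) * q s) (at s)"
    using assms(3)[OF assms(2)] by (auto intro!: derivative_eq_intros)
  moreover have "((\<lambda>s. p s ^ m) has_real_derivative 0) (at s)"
    by (rule has_field_derivative_transform_within_open[OF DERIV_const J])
      (use assms(7) in \<open>auto simp: J_def\<close>)
  ultimately have "real m * p s ^ (m - 1) * q s = 0"
    by (rule DERIV_unique)
  then show False
    using assms(2,5,6,7) by simp
qed

lemma c_star_unique:
  assumes "c > 0" "l < k" "k \<le> n" "real (n choose k) * c ^ k = real (n choose l) * c ^ l"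
  shows "c = c_star n k l"
proof -
  have "c ^ k = c ^ (k - l) * c ^ l"
    using assms(2) by (simp flip: power_add)
  then have "c ^ (k - l) = real (n choose l) / real (n choose k)"
    using assms by (simp add: field_simps)
  then have "c_star n k l = (c ^ (k - l)) powr (1 / real (k - l))"
    using assms(2) by (simp add: c_star_def of_nat_diff)
  also have "\<dots> = c"
    using assms(1,2) by (simp add: powr_powr flip: powr_realpow)
  finally show ?thesis by simp
qed

section \<open>Sufficiency: from the differential equation to the symmetric functions\<close>

text \<open>By \<open>h\<close> the products containing \<open>i\<close> make up the share j/n of
  \<open>esym j UNIV a\<close>. Hence n \<sigma>(j) is the common value of the two symmetric
  functions times n p^j + t j p^(j-1), and the difference for \<open>k\<close> and \<open>l\<close>
  is a multiple of the left side of \<open>ode\<close>.\<close>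

lemma esym_equal_of_ode:
  fixes a :: "'a::finite \<Rightarrow> real"
  assumes "l < k" and e: "esym k UNIV a = esym l UNIV a" "esym k UNIV a > 0"
    and h: "\<And>j. j \<in> {k, l} \<Longrightarrow> j > 0 \<Longrightarrow>
      real CARD('a) * (a i * esym (j - 1) (UNIV - {i}) a) = real j * esym j UNIV a"
    and "p > 0" "t < 0"
    and ode: "real CARD('a) * (p ^ k - p ^ l) + t * (real k * p ^ (k - 1) - real l * p ^ (l - 1)) = 0"
  defines "\<sigma> \<equiv> \<lambda>j. esym j UNIV (\<lambda>m. (if m = i then p + t else p) * a m)"
  shows "\<sigma> k = \<sigma> l" "\<sigma> l \<noteq> 0"
proof -
  let ?n = "real CARD('a)" and ?e = "esym k UNIV a"
  have \<sigma>: "?n * \<sigma> j = ?e * (?n * p ^ j + t * (real j * p ^ (j - 1)))" if j: "j \<in> {k, l}" for j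
  proof (cases j)
    case 0
    then show ?thesis
      using j e(1) assms(1) by (auto simp: \<sigma>_def)
  next
    case (Suc m)
    have "?n * \<sigma> j = p ^ j * ?n * esym j UNIV a + t * p ^ m * (?n * (a i * esym m (UNIV - {i}) a))"
      unfolding \<sigma>_def Suc by (subst esym_scale_except) (simp_all add: algebra_simps)
    also have "?n * (a i * esym m (UNIV - {i}) a) = real j * esym j UNIV a"
      using h[OF j] Suc by simp
    also have "esym j UNIV a = ?e"
      using j e(1) by auto
    finally show ?thesis
      by (simp add: Suc algebra_simps)
  qed
  have "?n * \<sigma> k - ?n * \<sigma> l = ?e * (?n * (p ^ k - p ^ l) + t * (real k * p ^ (k - 1) - real l * p ^ (l - 1)))"
    using \<sigma>[of k] \<sigma>[of l] by (simp add: algebra_simps)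
  then have "?n * \<sigma> k = ?n * \<sigma> l"
    using ode by simp
  then show eq: "\<sigma> k = \<sigma> l"
    by simp
  \<comment> \<open>If both values vanished, division by a power of \<open>p\<close> would give n p
    + t j = 0 for \<open>j = k\<close> and \<open>j = l\<close>, impossible for nonzero
    \<open>t\<close>. The case \<open>l = 0\<close> is excluded by \<sigma>(0) = 1.\<close>
  show "\<sigma> l \<noteq> 0"
  proof
    assume "\<sigma> l = 0"
    then have zero: "?n * p ^ j + t * (real j * p ^ (j - 1)) = 0" if "j \<in> {k, l}" for j
      using \<sigma>[OF that] that eq e(2) by auto
    have lin: "?n * p + t * real j = 0" if "j \<in> {k, l}" "j > 0" for j
    proof -
      have "p ^ (j - 1) * (?n * p + t * real j) = 0"
        using zero[OF that(1)] by (simp add: power_minus_mult[OF that(2), symmetric] algebra_simps del: power_minus_mult)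
      then show ?thesis
        using \<open>p > 0\<close> by simp
    qed
    have "l > 0"
      using zero[of l] by (cases l) auto
    then have "?n * p + t * real k = 0" "?n * p + t * real l = 0"
      using lin[of k] lin[of l] assms(1) by simp_all
    then have "t * real k = t * real l"
      by linarith
    then show False
      using \<open>t < 0\<close> assms(1) by simp
  qed
qed

text \<open>For equal entries the share of \<open>i\<close> is a matter of counting: j C(n, j) = n
  C(n-1, j-1).\<close>

lemma esym_const_weighted:
  fixes a :: "'a::finite \<Rightarrow> real"
  assumes "\<And>m. a m = c" "j > 0"
  shows "real CARD('a) * (a i * esym (j - 1) (UNIV - {i}) a) = real j * esym j UNIV a"
proof -
  have a: "a = (\<lambda>_. c)"
    using assms(1) by auto
  have "real j * real (CARD('a) choose j) = real CARD('a) * real ((CARD('a) - 1) choose (j - 1))"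
    using times_binomial_minus1_eq[OF assms(2), of "CARD('a)"] by (metis of_nat_mult)
  moreover have "real CARD('a) * (a i * esym (j - 1) (UNIV - {i}) a) =
      (real CARD('a) * real ((CARD('a) - 1) choose (j - 1))) * (c ^ (j - 1) * c)"
    by (simp add: a esym_const)
  moreover have "real j * esym j UNIV a = (real j * real (CARD('a) choose j)) * c ^ j"
    by (simp add: a esym_const)
  ultimately show ?thesis
    using power_minus_mult[OF assms(2), of c] by simp
qed

lemma esym_full_weighted:
  fixes a :: "'a::finite \<Rightarrow> real"
  shows "a i * esym (CARD('a) - 1) (UNIV - {i}) a = esym CARD('a) UNIV a"
proof -
  have "esym (CARD('a) - 1) (UNIV - {i}) a = prod a (UNIV - {i})"
    using esym_card[of "UNIV - {i}" a] by simp
  then show ?thesis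
    by (simp add: esym_card prod.remove[of UNIV i])
qed

lemma inner_diag_eq_quad: "1/2 * (x \<bullet> (diag a *v x)) = quad a x"
proof -
  have "(diag a *v x) $ i = a $ i * x $ i" for i
    by (simp add: diag_def matrix_vector_mult_def if_distrib[of "\<lambda>z. z * _"] cong: if_cong)
  then show ?thesis
    by (simp add: inner_vec_def quad_def power2_eq_square mult_ac)
qed

theorem proposition1p1:
  fixes a :: "real^'n" and k l :: nat and \<alpha> \<beta> :: real
  assumes "CARD('n) \<ge> 2" and "l < k" and "k \<le> CARD('n)"
    and "diag a \<in> A_set k l"
    and "0 < \<alpha>" and "\<alpha> < \<beta>"
  defines "\<Omega> \<equiv> {x :: real^'n. \<alpha> < 1/2 * (\<Sum>i\<in>UNIV. a $ i * (x $ i)^2) \<and>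
                              1/2 * (\<Sum>i\<in>UNIV. a $ i * (x $ i)^2) < \<beta>}"
  shows "(\<exists>w :: real \<Rightarrow> real. C2_real_on {\<alpha><..<\<beta>} w \<and>
            (\<exists>s\<in>{\<alpha><..<\<beta>}. deriv (deriv w) s \<noteq> 0) \<and>
            G_Sym_on (diag a) \<Omega> (\<lambda>x. w (1/2 * (\<Sum>i\<in>UNIV. a $ i * (x $ i)^2))) \<and>
            quotient_solution k l \<Omega> (\<lambda>x. w (1/2 * (\<Sum>i\<in>UNIV. a $ i * (x $ i)^2))))
         \<longleftrightarrow> (l = 0 \<and> k = CARD('n)) \<or> (\<forall>i. a $ i = c_star CARD('n) k l)"
    (is "(\<exists>w. ?good w) \<longleftrightarrow> _")
proof -
  let ?I = "{\<alpha><..<\<beta>}"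
  have \<Omega>: "x \<in> \<Omega> \<longleftrightarrow> quad a x \<in> ?I" for x
    by (simp add: \<Omega>_def quad_def)
  have a: "a $ i > 0" for i
  proof -
    have "axis i 1 \<bullet> (diag a *v axis i 1) > 0"
      using assms(4) by (auto simp: A_set_def axis_eq_0_iff)
    then show ?thesis
      using inner_diag_eq_quad[of "axis i 1" a] quad_axis[of a i 1] by simp
  qed
  have e: "esym k UNIV (($) a) = esym l UNIV (($) a)"
    using assms(4) by (simp add: A_set_def elem_sym_eigenvalues_diag)
  have e_pos: "esym k UNIV (($) a) > 0"
    using a assms(3) by (intro esym_pos) auto
  show ?thesis
  proof
    assume "\<exists>w. ?good w"
    then obtain w s0 where C2: "C2_real_on ?I w" and s0: "s0 \<in> ?I" "deriv (deriv w) s0 \<noteq> 0"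
      and sol: "quotient_solution k l \<Omega> (\<lambda>x. w (quad a x))"
      unfolding quad_def by blast
    define p where "p = deriv w"
    define q where "q = deriv p"
    have dw: "(w has_real_derivative p s) (at s)" if "s \<in> ?I" for s
      using C2 that unfolding C2_real_on_def p_def DERIV_deriv_iff_real_differentiable
      by (meson differentiable_on_eq_differentiable_at open_greaterThanLessThan)
    have dp: "(p has_real_derivative q s) (at s)" if "s \<in> ?I" for s
      using C2 that unfolding C2_real_on_def q_def p_def DERIV_deriv_iff_real_differentiable
      by (meson differentiable_on_eq_differentiable_at open_greaterThanLessThan)
    have contq: "continuous_on ?I q"
      using C2 by (simp add: C2_real_on_def p_def q_def)
    have axis_eq: "esym k UNIV (\<lambda>m. (if m = i then p s + 2 * s * q s else p s) * a $ m) =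
        esym l UNIV (\<lambda>m. (if m = i then p s + 2 * s * q s else p s) * a $ m) \<and>
        esym k UNIV (\<lambda>m. (if m = i then p s + 2 * s * q s else p s) * a $ m) \<noteq> 0"
      if s: "s \<in> ?I" for s i
    proof -
      \<comment> \<open>The \<open>i\<close>-th axis meets the level set of value \<open>s\<close>
        at this coordinate.\<close>
      define x :: "real^'n" where "x = axis i (sqrt (2 * s / a $ i))"
      have qx: "quad a x = s"
        using quad_axis[of a i "sqrt (2 * s / a $ i)"] a[of i] s assms(5) by (simp add: x_def)
      then have "hessian (\<lambda>x. w (quad a x)) x = radial_hessian (p s) (q s) a x"
        using hessian_radial[of ?I w p q a x] dw dp s by simp
      moreover have "elem_sym k (eigenvalues (hessian (\<lambda>x. w (quad a x)) x)) /
          elem_sym l (eigenvalues (hessian (\<lambda>x. w (quad a x)) x)) = 1"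
        using sol s qx \<Omega> unfolding quotient_solution_def by blast
      moreover have "elem_sym j (eigenvalues (radial_hessian (p s) (q s) a x)) =
          esym j UNIV (\<lambda>m. (if m = i then p s + 2 * s * q s else p s) * a $ m)" for j
        using elem_sym_radial_hessian_axis[of j "p s" "q s" a i "sqrt (2 * s / a $ i)"]
        unfolding qx[unfolded x_def] x_def .
      \<comment> \<open>A quotient equal to 1 has a nonzero denominator, so the equal numerator is
        nonzero too.\<close>
      ultimately show ?thesis
        by (metis divide_eq_1_iff)
    qed
    have "\<forall>i. a $ i = c_star CARD('n) k l" if excl: "\<not> (l = 0 \<and> k = CARD('n))"
    proof -
      have const: "a $ i = a $ j" for i j
      proof (rule ccontr)
        assume "a $ i \<noteq> a $ j"
        then obtain c where c: "\<And>p t. t \<noteq> 0 \<Longrightarrow>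
          (\<And>i. esym k UNIV (\<lambda>m. (if m = i then p + t else p) * a $ m) =
            esym l UNIV (\<lambda>m. (if m = i then p + t else p) * a $ m)) \<Longrightarrow>
          (\<And>i. esym k UNIV (\<lambda>m. (if m = i then p + t else p) * a $ m) \<noteq> 0) \<Longrightarrow> p \<noteq> 0 \<and> p ^ (k - l) = c"
          by (rule pointwise_rigidity[OF assms(2,3) excl a]) blast
        have "p s \<noteq> 0 \<and> p s ^ (k - l) = c" if "s \<in> ?I" "q s \<noteq> 0" for s
          by (rule c[of "2 * s * q s"]) (use axis_eq[OF that(1)] that assms(5) in blast | use that assms(5) in simp)+
        then show False
          using power_not_locally_constant[of ?I s0 p q "k - l" c] s0 dp contq assms(2)
          by (auto simp: p_def q_def)
      qed
      show "\<forall>i. a $ i = c_star CARD('n) k l"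
      proof
        fix i
        have "($) a = (\<lambda>_. a $ i)"
          using const by auto
        then have "real (CARD('n) choose k) * (a $ i) ^ k = real (CARD('n) choose l) * (a $ i) ^ l"
          using e by (metis esym_const finite)
        then show "a $ i = c_star CARD('n) k l"
          using a assms(2,3) by (intro c_star_unique)
      qed
    qed
    then show "(l = 0 \<and> k = CARD('n)) \<or> (\<forall>i. a $ i = c_star CARD('n) k l)"
      by blast
  next
    assume cases: "(l = 0 \<and> k = CARD('n)) \<or> (\<forall>i. a $ i = c_star CARD('n) k l)"
    obtain w p q :: "real \<Rightarrow> real" where
      dw: "\<And>s. s \<in> ?I \<Longrightarrow> (w has_real_derivative p s) (at s)" and
      dp: "\<And>s. s \<in> ?I \<Longrightarrow> (p has_real_derivative q s) (at s)" and
      contq: "continuous_on ?I q" and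
      p_pos: "\<And>s. s \<in> ?I \<Longrightarrow> p s > 0" and q_neg: "\<And>s. s \<in> ?I \<Longrightarrow> q s < 0" and
      ode: "\<And>s. s \<in> ?I \<Longrightarrow> real CARD('n) * (p s ^ k - p s ^ l) +
        2 * s * q s * (real k * p s ^ (k - 1) - real l * p s ^ (l - 1)) = 0"
      by (rule radial_ode_solution[OF assms(2) _ assms(5), of "CARD('n)" \<beta>]) auto
    have deriv_w: "deriv w s = p s" if "s \<in> ?I" for s
      using dw[OF that] by (rule DERIV_imp_deriv)
    \<comment> \<open>\<open>deriv w\<close> is known to agree with \<open>p\<close> only on the
      open interval, so its derivative is obtained by local transfer.\<close>
    have d2: "(deriv w has_real_derivative q s) (at s)" if "s \<in> ?I" for s
      by (rule has_field_derivative_transform_within_open[OF dp[OF that] _ that]) (simp_all add: deriv_w)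
    then have deriv2_w: "deriv (deriv w) s = q s" if "s \<in> ?I" for s
      using that by (blast intro: DERIV_imp_deriv)
    have "C2_real_on ?I w"
    proof -
      have "w differentiable_on ?I" "deriv w differentiable_on ?I"
        using dw d2 by (meson differentiable_at_imp_differentiable_on real_differentiable_def)+
      moreover have "continuous_on ?I (deriv (deriv w))"
        using contq by (rule continuous_on_eq) (use deriv2_w in auto)
      ultimately show ?thesis
        by (simp add: C2_real_on_def)
    qed
    moreover have "\<exists>s\<in>?I. deriv (deriv w) s \<noteq> 0"
    proof
      show "(\<alpha> + \<beta>) / 2 \<in> ?I"
        using assms(6) by simp
      then show "deriv (deriv w) ((\<alpha> + \<beta>) / 2) \<noteq> 0"
        using deriv2_w q_neg by fastforce
    qed
    moreover have "G_Sym_on (diag a) \<Omega> (\<lambda>x. w (quad a x))"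
      unfolding G_Sym_on_def inner_diag_eq_quad by blast
    moreover have "quotient_solution k l \<Omega> (\<lambda>x. w (quad a x))"
      unfolding quotient_solution_def
    proof (intro conjI ballI)
      show "C2_on \<Omega> (\<lambda>x. w (quad a x))"
        by (rule C2_on_radial[of ?I w p q]) (use dw dp contq \<Omega> in auto)
    next
      fix x assume "x \<in> \<Omega>"
      then have s: "quad a x \<in> ?I" by (simp add: \<Omega>)
      define s where "s = quad a x"
      \<comment> \<open>Any axis serves for comparison: in both cases the symmetric functions at
        \<open>x\<close> equal those at the point of that axis on the same level set.\<close>
      obtain i :: 'n where True by simp
      define \<sigma> where "\<sigma> = (\<lambda>j. esym j UNIV (\<lambda>m. (if m = i then p s + 2 * s * q s else p s) * a $ m))"
      have hess: "elem_sym j (eigenvalues (hessian (\<lambda>x. w (quad a x)) x)) = \<sigma> j" if "j \<in> {k, l}" for j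
      proof -
        have "hessian (\<lambda>x. w (quad a x)) x = radial_hessian (p s) (q s) a x"
          using hessian_radial[of ?I w p q a x] dw dp s by (simp add: s_def)
        moreover have "elem_sym j (eigenvalues (radial_hessian (p s) (q s) a x)) = \<sigma> j"
          using cases
        proof
          assume "l = 0 \<and> k = CARD('n)"
          then show ?thesis
            using that elem_sym_radial_hessian_full[of a "p s" "q s" x i, folded s_def] a
            by (auto simp: \<sigma>_def elem_sym_0)
        next
          assume "\<forall>i. a $ i = c_star CARD('n) k l"
          then show ?thesis
            using elem_sym_radial_hessian_const[of a _ j "p s" "q s" x i, folded s_def] by (simp add: \<sigma>_def)
        qed
        ultimately show ?thesis by simp
      qed
      have weighted: "real CARD('n) * (a $ i * esym (j - 1) (UNIV - {i}) (($) a)) = real j * esym j UNIV (($) a)"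
        if "j \<in> {k, l}" "j > 0" for j
        using cases
      proof
        assume "l = 0 \<and> k = CARD('n)"
        then show ?thesis
          using that esym_full_weighted[of "($) a" i] by auto
      next
        assume "\<forall>i. a $ i = c_star CARD('n) k l"
        then show ?thesis
          using that by (intro esym_const_weighted) auto
      qed
      have sI: "s \<in> ?I"
        using s by (simp add: s_def)
      then have neg: "2 * s * q s < 0"
        using q_neg assms(5) by (simp add: mult_pos_neg)
      have "\<sigma> k = \<sigma> l" "\<sigma> l \<noteq> 0"
        unfolding \<sigma>_def
        using esym_equal_of_ode[OF assms(2) e e_pos weighted p_pos[OF sI] neg ode[OF sI]] by simp_all
      then show "elem_sym k (eigenvalues (hessian (\<lambda>x. w (quad a x)) x)) /
          elem_sym l (eigenvalues (hessian (\<lambda>x. w (quad a x)) x)) = 1"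
        by (simp add: hess)
    qed
    ultimately show "\<exists>w. ?good w"
      unfolding quad_def by blast
  qed
qed

end
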